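(* Consider the linear system $x_t = Ax_{t-1}+Bu_t$ with initial condition $x_0$, and a sequence of cost functions $L_t(x,u)=f_t^x(x)+f_t^u(u)$, such that Assumptions (i), (ii), (iii) of the context hold. Let $\alpha_u > \frac{2-\sqrt 2}{2+\sqrt 2}\, l_u$, and let the positive step sizes $\gamma_v,\gamma_x$ satisfy $$\frac{2-\sqrt 2}{2\alpha_u} < \gamma_v \le \frac{2}{l_u+\alpha_u}, \qquad \frac{2\|A\|-1}{2\|A\|\alpha_x} < \gamma_x \le \frac{2}{l_x+\alpha_x}.$$ Let $u_t,x_t$ be generated by Algorithm 1 (described in the context) in closed loop with the system. Let $\theta_t\in\mathbb{D}_\theta$ and $\eta_t\in\mathbb{D}_\eta$ for all $t\in\mathbb{N}$, where $\mathbb{D}_\theta\subset\mathbb{R}^n$ and $\mathbb{D}_\eta\subset\mathbb{R}^m$ are compact sets. If the path length $\sum_{t=1}^T\|\theta_t-\theta_{t-1}\|+\sum_{t=1}^T\|\eta_t-\eta_{t-1}\|$ is sublinear in $T$, then the regret $\mathcal{R}(T)$ of Algorithm 1 is sublinear in $T$.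
   Context: A quantity $q(T)$ is sublinear in $T$ if $q(T)/T\to 0$ as $T\to\infty$. $\|\cdot\|$ is the Euclidean norm for vectors and the induced (spectral) norm for matrices. The system is $x_t = Ax_{t-1}+Bu_t$, $t\ge 1$, with $A\in\mathbb{R}^{n\times n}$, $B\in\mathbb{R}^{n\times m}$, given $x_0\in\mathbb{R}^n$. At each time $t\ge 1$ an input $u_t\in\mathbb{R}^m$ is chosen and applied, then the cost function $L_t:\mathbb{R}^n\times\mathbb{R}^m\to\mathbb{R}$ is revealed. Assumptions. (i) For every $t\ge 0$: $L_t(x,u)=f_t^x(x)+f_t^u(u)$, where $f_t^x:\mathbb{R}^n\to\mathbb{R}$ is (differentiable,) $\alpha_x$-strongly convex and $l_x$-smooth, and $f_t^u:\mathbb{R}^m\to\mathbb{R}$ is $\alpha_u$-strongly convex and $l_u$-smooth, with constants independent of $t$. Here $f$ is $\alpha$-strongly convex ($\alpha>0$) if $f(y)\ge f(x)+\langle\nabla f(x),y-x\rangle+\frac{\alpha}{2}\|y-x\|^2$ for all $x,y$, and $l$-smooth if $f(y)\le f(x)+\langle\nabla f(x),y-x\rangle+\frac{l}{2}\|y-x\|^2$ for all $x,y$. Put $\theta_t=\arg\min_x f_t^x(x)$, $\eta_t=\arg\min_u f_t^u(u)$. (ii) For all $t\ge 1$: $\theta_t=A\theta_t+B\eta_t$. (iii) $(A,B)$ is controllable with controllability index $\mu$, i.e. $\operatorname{rank} S_c=n$ with $S_c=(B\ \ AB\ \cdots\ A^{\mu-1}B)\in\mathbb{R}^{n\times \mu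 m}$; moreover $\|A\|<\frac{l_x+\alpha_x}{2(l_x-\alpha_x)}$ (the right-hand side is read as $+\infty$ if $l_x=\alpha_x$). For $A=0$ the lower bound $\frac{2\|A\|-1}{2\|A\|\alpha_x}$ on $\gamma_x$ is read as $-\infty$. Algorithm 1. Let $W=\begin{pmatrix}0_{m\times(\mu-1)m}&0_{m\times m}\\ I_{(\mu-1)m}&0_{(\mu-1)m\times m}\end{pmatrix}\in\mathbb{R}^{\mu m\times\mu m}$ and $e=\begin{pmatrix}0_{m\times(\mu-1)m}&I_m\end{pmatrix}\in\mathbb{R}^{m\times\mu m}$. Given step sizes $\gamma_v,\gamma_x$ and initialization $v_0\in\mathbb{R}^m$, $x_0$, and with $g_t=0$ for $t<1$, at each time $t\ge 1$ (given $x_{t-1}$ and $L_{t-1}$) compute $$v_t=v_{t-1}-\gamma_v\nabla f_{t-1}^u(v_{t-1}),\qquad \hat V_t=(v_t^T,\dots,v_t^T)^T\in\mathbb{R}^{\mu m},$$ $$\hat x_{t+\mu-1}=A^\mu x_{t-1}+S_c\hat V_t+S_c\sum_{i=1}^{\mu-1}W^i g_{t-i},$$ $$g_t=-\gamma_x S_c^T(S_cS_c^T)^{-1}\nabla f_{t-1}^x(\hat x_{t+\mu-1}),\qquad u_t=v_t+\sum_{i=0}^{\mu-1}eW^i g_{t-i},$$ and apply $u_t$ to the system, giving $x_t=Ax_{t-1}+Bu_t$. The fictitious cost $L_0=f_0^x+f_0^u$ is fixed so that it satisfies (i) and its minimizers are $\eta_0=v_0$ and $\theta_0=\hat x_\mu$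 (hence $v_1=v_0$, $g_1=0$, and $\theta_0=\hat x_\mu=A^\mu x_0+S_c(v_0^T,\dots,v_0^T)^T$). Regret: $\mathcal{R}=\mathcal{R}(T)=\sum_{t=1}^T\big(L_t(x_t,u_t)-L_t(x_t^*,u_t^* )\big)$, where $(x_1^*,\dots,x_T^* )$, $(u_1^*,\dots,u_T^* )$ solve $\min\sum_{t=1}^T L_t(x_t,u_t)$ over $u_1,x_1,\dots,u_T,x_T$ subject to $x_t=Ax_{t-1}+Bu_t$, $t=1,\dots,T$, with the given $x_0$. *)

theory Defs
  imports "HOL-Analysis.Analysis"
begin

definition sublinear :: "(nat \<Rightarrow> real) \<Rightarrow> bool" where
  "sublinear q \<longleftrightarrow> (\<lambda>T. q T / real T) \<longlonglongrightarrow> 0"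

(* The norm of the type real^'n^'m is the Frobenius norm, hence the explicit onorm. *)
definition spectral_norm :: "real^'n^'m \<Rightarrow> real" where
  "spectral_norm A = onorm (\<lambda>x. A *v x)"

(* The class operation ^ does not give matrix powers here: multiplication of the
   vec type is componentwise. *)
primrec matpow :: "'a::semiring_1^'n^'n \<Rightarrow> nat \<Rightarrow> 'a^'n^'n" where
  "matpow A 0 = mat 1"
| "matpow A (Suc k) = A ** matpow A k"

definition gradient :: "('a::real_inner \<Rightarrow> real) \<Rightarrow> 'a \<Rightarrow> 'a" where
  "gradient f x = (THE D. GDERIV f x :> D)"

definition strongly_convex :: "real \<Rightarrow> ('a::real_inner \<Rightarrow> real) \<Rightarrow> bool" where
  "strongly_convex \<alpha> f \<longleftrightarrow> \<alpha> > 0 \<and>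
     (\<forall>x y. f y \<ge> f x + gradient f x \<bullet> (y - x) + \<alpha> / 2 * (norm (y - x))\<^sup>2)"

definition smooth :: "real \<Rightarrow> ('a::real_inner \<Rightarrow> real) \<Rightarrow> bool" where
  "smooth l f \<longleftrightarrow>
     (\<forall>x y. f y \<le> f x + gradient f x \<bullet> (y - x) + l / 2 * (norm (y - x))\<^sup>2)"

definition is_minimizer :: "('a \<Rightarrow> real) \<Rightarrow> 'a \<Rightarrow> bool" where
  "is_minimizer f z \<longleftrightarrow> is_arg_min f (\<lambda>_. True) z"

(* A vector of R^(mu m) has type real^('k * 'm), where 'k is a finite linear order with mu
   elements indexing the mu blocks; blk i in {0, ..., mu - 1} is the position of block i. *)
definition blk :: "'k::{finite,linorder} \<Rightarrow> nat" where
  "blk i = card {j. j < i}"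

lemma bij_betw_blk: "bij_betw (blk :: 'k::{finite,linorder} \<Rightarrow> nat) UNIV {..<CARD('k)}"
proof -
  have mono: "blk i < blk j" if "i < j" for i j :: 'k
    unfolding blk_def using that by (intro psubset_card_mono) auto
  have inj: "inj (blk :: 'k \<Rightarrow> nat)"
    by (rule linorder_injI) (use mono in \<open>metis less_irrefl\<close>)
  have "blk i < CARD('k)" for i :: 'k
    unfolding blk_def by (intro psubset_card_mono) auto
  then have "range (blk :: 'k \<Rightarrow> nat) \<subseteq> {..<CARD('k)}" by auto
  moreover have "card (range (blk :: 'k \<Rightarrow> nat)) = CARD('k)"
    using inj by (rule card_image)
  ultimately have "range (blk :: 'k \<Rightarrow> nat) = {..<CARD('k)}"
    by (intro card_subset_eq) auto
  with inj show ?thesis by (simp add: bij_betw_def)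
qed

(* (B, A B, ..., A^(mu-1) B) *)
definition ctrl_mat ::
  "real^'n^'n \<Rightarrow> real^'m::finite^'n \<Rightarrow> real^('k::{finite,linorder} \<times> 'm)^'n" where
  "ctrl_mat A B = (\<chi> r c. (matpow A (blk (fst c)) ** B) $ r $ snd c)"

definition W_mat :: "real^('k::{finite,linorder} \<times> 'm::finite)^('k \<times> 'm)" where
  "W_mat = (\<chi> r c. if blk (fst r) = blk (fst c) + 1 \<and> snd r = snd c then 1 else 0)"

definition e_mat :: "real^('k::{finite,linorder} \<times> 'm::finite)^'m" where
  "e_mat = (\<chi> r c. if blk (fst c) = CARD('k) - 1 \<and> snd c = r then 1 else 0)"

definition stack :: "real^'m::finite \<Rightarrow> real^('k::{finite,linorder} \<times> 'm)" where
  "stack v = (\<chi> c. v $ snd c)"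

definition cost_assumption ::
  "real \<Rightarrow> real \<Rightarrow> real \<Rightarrow> real \<Rightarrow> (nat \<Rightarrow> real^'n \<Rightarrow> real^'m \<Rightarrow> real) \<Rightarrow>
   (nat \<Rightarrow> real^'n \<Rightarrow> real) \<Rightarrow> (nat \<Rightarrow> real^'m \<Rightarrow> real) \<Rightarrow> bool" where
  "cost_assumption \<alpha>\<^sub>x l\<^sub>x \<alpha>\<^sub>u l\<^sub>u L fx fu \<longleftrightarrow>
     (\<forall>t. (\<forall>x u. L t x u = fx t x + fu t u) \<and>
          fx t differentiable_on UNIV \<and> strongly_convex \<alpha>\<^sub>x (fx t) \<and> smooth l\<^sub>x (fx t) \<and>
          fu t differentiable_on UNIV \<and> strongly_convex \<alpha>\<^sub>u (fu t) \<and> smooth l\<^sub>u (fu t))"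

(* The second conjunct holds vacuously if l_x = alpha_x, where the bound is +infinity. *)
definition system_assumption ::
  "'k::{finite,linorder} itself \<Rightarrow> real \<Rightarrow> real \<Rightarrow> real^'n^'n \<Rightarrow> real^'m::finite^'n \<Rightarrow> bool" where
  "system_assumption (_ :: 'k itself) \<alpha>\<^sub>x l\<^sub>x A B \<longleftrightarrow>
     rank (ctrl_mat A B :: real^('k \<times> 'm)^'n) = CARD('n) \<and>
     (l\<^sub>x \<noteq> \<alpha>\<^sub>x \<longrightarrow> spectral_norm A < (l\<^sub>x + \<alpha>\<^sub>x) / (2 * (l\<^sub>x - \<alpha>\<^sub>x)))"

(* g t for t < 1 is encoded by g 0 = 0: the subtraction t - i on nat truncates at 0.
   The sequences v and x start at the given initial values v 0 and x 0. *)
definition algorithm1 ::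
  "real^'n^'n \<Rightarrow> real^'m::finite^'n \<Rightarrow> real \<Rightarrow> real \<Rightarrow>
   (nat \<Rightarrow> real^'n \<Rightarrow> real) \<Rightarrow> (nat \<Rightarrow> real^'m \<Rightarrow> real) \<Rightarrow>
   (nat \<Rightarrow> real^'n) \<Rightarrow> (nat \<Rightarrow> real^'m) \<Rightarrow> (nat \<Rightarrow> real^'m) \<Rightarrow> (nat \<Rightarrow> real^'n) \<Rightarrow>
   (nat \<Rightarrow> real^('k::{finite,linorder} \<times> 'm)) \<Rightarrow> bool" where
  "algorithm1 A B \<gamma>\<^sub>v \<gamma>\<^sub>x fx fu x u v xhat g \<longleftrightarrow>
     (let \<mu> = CARD('k);
          S = (ctrl_mat A B :: real^('k \<times> 'm)^'n);
          W = (W_mat :: real^('k \<times> 'm)^('k \<times> 'm));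
          e = (e_mat :: real^('k \<times> 'm)^'m)
      in g 0 = 0 \<and>
        (\<forall>t\<ge>1.
           v t = v (t - 1) - \<gamma>\<^sub>v *\<^sub>R gradient (fu (t - 1)) (v (t - 1)) \<and>
           xhat (t + \<mu> - 1) = matpow A \<mu> *v x (t - 1) + S *v stack (v t)
              + S *v (\<Sum>i=1..\<mu> - 1. matpow W i *v g (t - i)) \<and>
           g t = - \<gamma>\<^sub>x *\<^sub>R ((transpose S ** matrix_inv (S ** transpose S))
              *v gradient (fx (t - 1)) (xhat (t + \<mu> - 1))) \<and>
           u t = v t + (\<Sum>i=0..\<mu> - 1. (e ** matpow W i) *v g (t - i)) \<and>
           x t = A *v x (t - 1) + B *v u t))"

definition trajectory ::
  "real^'n^'n \<Rightarrow> real^'m^'n \<Rightarrow> real^'n \<Rightarrow> nat \<Rightarrow> (nat \<Rightarrow> real^'n) \<Rightarrow> (nat \<Rightarrow> real^'m) \<Rightarrow> bool"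
where
  "trajectory A B x\<^sub>0 T x u \<longleftrightarrow>
     x 0 = x\<^sub>0 \<and> (\<forall>t\<in>{1..T}. x t = A *v x (t - 1) + B *v u t)"

definition optimal_trajectory ::
  "real^'n^'n \<Rightarrow> real^'m^'n \<Rightarrow> (nat \<Rightarrow> real^'n \<Rightarrow> real^'m \<Rightarrow> real) \<Rightarrow> real^'n \<Rightarrow> nat \<Rightarrow>
   (nat \<Rightarrow> real^'n) \<Rightarrow> (nat \<Rightarrow> real^'m) \<Rightarrow> bool" where
  "optimal_trajectory A B L x\<^sub>0 T xs us \<longleftrightarrow>
     is_arg_min (\<lambda>(x, u). \<Sum>t=1..T. L t (x t) (u t)) (\<lambda>(x, u). trajectory A B x\<^sub>0 T x u) (xs, us)"

definition regret ::
  "(nat \<Rightarrow> real^'n \<Rightarrow> real^'m \<Rightarrow> real) \<Rightarrow> (nat \<Rightarrow> real^'n) \<Rightarrow> (nat \<Rightarrow> real^'m) \<Rightarrow>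
   (nat \<Rightarrow> real^'n) \<Rightarrow> (nat \<Rightarrow> real^'m) \<Rightarrow> nat \<Rightarrow> real" where
  "regret L x u xs us T = (\<Sum>t=1..T. L t (x t) (u t) - L t (xs t) (us t))"

end

theory Submission
  imports Defs
begin

text \<open>
  The optimal trajectory costs at least \<open>\<Sum> L\<^sub>t(\<theta>\<^sub>t, \<eta>\<^sub>t)\<close>, the sum of the unconstrained minima, and
  smoothness bounds the excess of the closed loop over that sum by
  \<open>\<Sum> l\<^sub>x/2 \<parallel>x\<^sub>t - \<theta>\<^sub>t\<parallel>\<^sup>2 + l\<^sub>u/2 \<parallel>u\<^sub>t - \<eta>\<^sub>t\<parallel>\<^sup>2\<close>, because gradients vanish at minimizers. The regret is
  nonnegative, the closed loop being feasible, so it suffices that both error sequences are bounded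
  with norms of vanishing mean; their squares then have vanishing mean too. This property,
  \<open>vanishing_mean\<close>, is stable under sums, linear maps and time shifts, and passes through a
  contraction from its forcing term to its state (\<open>vanishing_mean_contraction\<close>). The increments of
  \<open>\<theta>\<close> and \<open>\<eta>\<close> have it by the assumptions on path length and compactness, and the proof
  propagates it through the loop.

  A gradient step of length at most \<open>2/(l + \<alpha>)\<close> contracts distances to the minimizer by the factor
  \<open>1 - \<gamma> \<alpha>\<close> (\<open>gradient_step_contraction\<close>). Hence \<open>v\<^sub>t - \<eta>\<^sub>t\<close> has vanishing mean.

  For the state, view the memory of the algorithm as a plan of \<open>\<mu>\<close> future inputs: at each time the
  last block is applied, and \<open>W\<close> shifts the others. Eliminating plan and state from the prediction
  gives the recursion (\<open>prediction_recursion\<close>)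
  \<open>xhat\<^sub>t\<^sub>+\<^sub>\<mu> = A (xhat\<^sub>t\<^sub>+\<^sub>\<mu>\<^sub>-\<^sub>1 - \<gamma>\<^sub>x \<nabla>f\<^sub>t\<^sub>-\<^sub>1(xhat\<^sub>t\<^sub>+\<^sub>\<mu>\<^sub>-\<^sub>1)) + B v\<^sub>t + S stack(v\<^sub>t\<^sub>+\<^sub>1 - v\<^sub>t)\<close>,
  a gradient step followed by the system map. Since \<open>\<theta>\<^sub>t = A \<theta>\<^sub>t + B \<eta>\<^sub>t\<close>, the prediction error
  contracts with factor \<open>\<parallel>A\<parallel> (1 - \<gamma>\<^sub>x \<alpha>\<^sub>x)\<close>, which the lower bound on \<open>\<gamma>\<^sub>x\<close> keeps below one half, and is
  driven by terms of vanishing mean, so it has vanishing mean as well. The corrections \<open>g\<close> are bounded by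
  a multiple of it through the gradients at the predictions, and the input errors \<open>u\<^sub>t - \<eta>\<^sub>t\<close> combine
  \<open>v\<^sub>t - \<eta>\<^sub>t\<close> with finitely many delayed corrections; both inherit the property.

  Because \<open>A\<close> may be unstable, the state error is not controlled by the input errors alone. But the
  prediction formula itself shows that \<open>A\<^sup>\<mu> (x\<^sub>t - \<theta>\<^sub>t)\<close> has vanishing mean, and \<open>vanishing_mean_deadbeat\<close>
  removes the powers of \<open>A\<close> one at a time along the state equation.
\<close>

section \<open>Gradient steps on strongly convex smooth functions\<close>

text \<open>
  The two quadratic bounds sandwich \<open>f\<close>, so evaluating them at any two distinct points compares the
  constants.
\<close>

lemma curvature_order:
  fixes f :: "'a::euclidean_space \<Rightarrow> real"
  assumes "strongly_convex \<alpha> f" "smooth l f"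
  shows "0 < \<alpha>" "\<alpha> \<le> l"
proof -
  show "0 < \<alpha>" using assms by (simp add: strongly_convex_def)
  obtain b :: 'a where b: "b \<in> Basis" using nonempty_Basis by blast
  have "f 0 + gradient f 0 \<bullet> (b - 0) + \<alpha> / 2 * (norm (b - 0))\<^sup>2
      \<le> f 0 + gradient f 0 \<bullet> (b - 0) + l / 2 * (norm (b - 0))\<^sup>2"
    using assms unfolding strongly_convex_def smooth_def by (meson order_trans)
  then show "\<alpha> \<le> l" using b by simp
qed

text \<open>
  A step of length \<open>1/l\<close> against the gradient lowers a smooth function by at least
  \<open>\<parallel>\<nabla>f\<parallel>\<^sup>2 / (2 l)\<close>, which is impossible at a minimizer unless the gradient is zero.
\<close>

lemma gradient_at_minimizer:
  fixes f :: "'a::euclidean_space \<Rightarrow> real"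
  assumes "strongly_convex \<alpha> f" "smooth l f" "is_minimizer f z"
  shows "gradient f z = 0"
proof -
  define G where "G = gradient f z"
  have l: "0 < l" using curvature_order[OF assms(1,2)] by simp
  have "f z \<le> f (z + - (1/l) *\<^sub>R G)"
    using assms(3) by (simp add: is_minimizer_def is_arg_min_linorder)
  also have "\<dots> \<le> f z + G \<bullet> (- (1/l) *\<^sub>R G) + l / 2 * (norm (- (1/l) *\<^sub>R G))\<^sup>2"
    using assms(2)[unfolded smooth_def, rule_format, of "z + - (1/l) *\<^sub>R G" z]
    by (simp only: G_def add_diff_cancel_left')
  also have "\<dots> = f z - (norm G)\<^sup>2 / (2 * l)"
    using l by (simp add: power2_norm_eq_inner[symmetric]) (simp add: power2_eq_square field_simps)
  finally have "(norm G)\<^sup>2 / (2 * l) \<le> 0" by simp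
  then show ?thesis using l unfolding G_def
    by (simp add: divide_le_0_iff)
qed

text \<open>
  Subtracting \<open>\<alpha>/2 \<parallel>\<cdot>\<parallel>\<^sup>2\<close> from \<open>f\<close> leaves a convex, \<open>(l - \<alpha>)\<close>-smooth function whose gradient increment is
  \<open>p x y\<close>; this is its cocoercivity.
\<close>

lemma gradient_cocoercive:
  fixes f :: "'a::euclidean_space \<Rightarrow> real"
  assumes sc: "strongly_convex \<alpha> f" and sm: "smooth l f"
  defines "p x y \<equiv> gradient f y - gradient f x - \<alpha> *\<^sub>R (y - x)"
  shows "(norm (p x y))\<^sup>2 \<le> (l - \<alpha>) * (p x y \<bullet> (y - x))"
proof -
  \<comment> \<open>Compare the lower bound anchored at \<open>x\<close> with the upper bound anchored at \<open>y\<close>, both taken at the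
    point reached from \<open>y\<close> by a step \<open>s\<close> along \<open>- p x y\<close>. Leaving \<open>s\<close> free covers \<open>l = \<alpha>\<close> as well,
    where no best step exists and letting \<open>s\<close> grow forces \<open>p x y = 0\<close>.\<close>
  have bregman: "f y - f x - gradient f x \<bullet> (y - x) - \<alpha> / 2 * (norm (y - x))\<^sup>2
      \<ge> s * (norm (p x y))\<^sup>2 - (l - \<alpha>) * s\<^sup>2 / 2 * (norm (p x y))\<^sup>2" for x y s
  proof -
    define q where "q = p x y"
    define z where "z = y - s *\<^sub>R q"
    have 1: "f z \<ge> f x + gradient f x \<bullet> (z - x) + \<alpha> / 2 * (norm (z - x))\<^sup>2"
      using sc by (simp add: strongly_convex_def)
    have 2: "f z \<le> f y + gradient f y \<bullet> (z - y) + l / 2 * (norm (z - y))\<^sup>2"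
      using sm by (simp add: smooth_def)
    have gy: "gradient f y = gradient f x + \<alpha> *\<^sub>R (y - x) + q"
      by (simp add: q_def p_def)
    have n1: "(norm (z - x))\<^sup>2 = (norm (y - x))\<^sup>2 - 2 * s * ((y - x) \<bullet> q) + s\<^sup>2 * (norm q)\<^sup>2"
    proof -
      have "(norm (r - s *\<^sub>R q))\<^sup>2 = (norm r)\<^sup>2 - 2 * s * (r \<bullet> q) + s\<^sup>2 * (norm q)\<^sup>2" for r
        unfolding power2_norm_eq_inner
        by (simp add: inner_diff_left inner_diff_right inner_commute power2_eq_square algebra_simps)
      from this[of "y - x"] show ?thesis by (simp add: z_def algebra_simps)
    qed
    have n2: "(norm (z - y))\<^sup>2 = s\<^sup>2 * (norm q)\<^sup>2"
      by (simp add: z_def power_mult_distrib)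
    have g1: "gradient f x \<bullet> (z - x) = gradient f x \<bullet> (y - x) - s * (gradient f x \<bullet> q)"
      by (simp add: z_def inner_diff_right)
    have g2: "gradient f y \<bullet> (z - y)
        = - s * (gradient f x \<bullet> q) - s * \<alpha> * ((y - x) \<bullet> q) - s * (norm q)\<^sup>2"
      unfolding gy z_def power2_norm_eq_inner by (simp add: inner_add_left algebra_simps)
    show ?thesis using 1 2 unfolding n1 n2 g1 g2 q_def[symmetric]
      by (simp add: field_simps)
  qed
  have swap: "p y x = - p x y" by (simp add: p_def algebra_simps)
  have key: "p x y \<bullet> (y - x) \<ge> (2 * s - (l - \<alpha>) * s\<^sup>2) * (norm (p x y))\<^sup>2" for s
  proof -
    have "(2 * s - (l - \<alpha>) * s\<^sup>2) * (norm (p x y))\<^sup>2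
       \<le> gradient f y \<bullet> (y - x) - gradient f x \<bullet> (y - x) - \<alpha> * (norm (y - x))\<^sup>2"
      using bregman[where x=x and y=y and s=s] bregman[where x=y and y=x and s=s]
      by (simp add: swap norm_minus_commute[of x y] algebra_simps inner_diff_right
          add_divide_distrib diff_divide_distrib)
    also have "\<dots> = p x y \<bullet> (y - x)"
      by (simp add: p_def inner_diff_left power2_norm_eq_inner)
    finally show ?thesis .
  qed
  show ?thesis
  proof (cases "l = \<alpha>")
    case True
    have "p x y = 0"
    proof (rule ccontr)
      assume "p x y \<noteq> 0"
      then show False
        \<comment> \<open>The coefficient of \<open>\<parallel>p x y\<parallel>\<^sup>2\<close> in \<open>key\<close> is now \<open>2 s\<close>, so this \<open>s\<close> makes the lower
          bound there exceed the nonnegative inner product.\<close>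
        using key[of "(p x y \<bullet> (y - x) + 1) / (norm (p x y))\<^sup>2"] key[of 0] True by simp
    qed
    then show ?thesis by simp
  next
    case False
    then have L: "0 < l - \<alpha>" using curvature_order[OF sc sm] by simp
    have "(2 * (1/(l-\<alpha>)) - (l - \<alpha>) * (1/(l-\<alpha>))\<^sup>2) = 1 / (l - \<alpha>)"
      using L by (simp add: power2_eq_square divide_simps)
    with key[of "1/(l-\<alpha>)"] have "(norm (p x y))\<^sup>2 / (l - \<alpha>) \<le> p x y \<bullet> (y - x)" by simp
    then show ?thesis using L by (simp add: pos_divide_le_eq mult.commute)
  qed
qed

text \<open>
  Cocoercivity anchored at the minimizer and cleared of denominators: equivalently
  \<open>\<langle>\<nabla>f y - \<alpha> (y - z), l (y - z) - \<nabla>f y\<rangle> \<ge> 0\<close>, so the gradient lies in the sector between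
  slopes \<open>\<alpha>\<close> and \<open>l\<close>.
\<close>

lemma gradient_sector:
  fixes f :: "'a::euclidean_space \<Rightarrow> real"
  assumes sc: "strongly_convex \<alpha> f" and sm: "smooth l f" and min: "is_minimizer f z"
  shows "(l + \<alpha>) * (gradient f y \<bullet> (y - z)) \<ge> \<alpha> * l * (norm (y - z))\<^sup>2 + (norm (gradient f y))\<^sup>2"
  using gradient_cocoercive[OF sc sm, of z y] gradient_at_minimizer[OF sc sm min]
  by (simp add: power2_norm_eq_inner inner_diff_left inner_diff_right inner_commute algebra_simps)

text \<open>
  By Cauchy-Schwarz, the sector condition becomes a quadratic inequality for \<open>\<parallel>\<nabla>f y\<parallel>\<close> with roots
  \<open>\<alpha> \<parallel>y - z\<parallel>\<close> and \<open>l \<parallel>y - z\<parallel>\<close>.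
\<close>

lemma gradient_norm_bounds:
  fixes f :: "'a::euclidean_space \<Rightarrow> real"
  assumes sc: "strongly_convex \<alpha> f" and sm: "smooth l f" and min: "is_minimizer f z"
  shows "\<alpha> * norm (y - z) \<le> norm (gradient f y)" "norm (gradient f y) \<le> l * norm (y - z)"
proof -
  define c where "c = norm (gradient f y)"
  define r where "r = norm (y - z)"
  note al = curvature_order[OF sc sm]
  have r: "0 \<le> r" by (simp add: r_def)
  have "(l + \<alpha>) * (gradient f y \<bullet> (y - z)) \<le> (l + \<alpha>) * (c * r)"
    using al norm_cauchy_schwarz[of "gradient f y" "y - z"]
    by (intro mult_left_mono) (auto simp: c_def r_def)
  then have "\<alpha> * l * r\<^sup>2 + c\<^sup>2 \<le> (l + \<alpha>) * (c * r)"
    using gradient_sector[OF assms, of y] by (simp add: c_def r_def)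
  then have prod: "(c - \<alpha> * r) * (c - l * r) \<le> 0"
    by (simp add: power2_eq_square algebra_simps)
  have ord: "\<alpha> * r \<le> l * r" using al r by (intro mult_right_mono) auto
  show "\<alpha> * norm (y - z) \<le> norm (gradient f y)" "norm (gradient f y) \<le> l * norm (y - z)"
    using prod ord unfolding c_def[symmetric] r_def[symmetric]
    by (auto simp: mult_le_0_iff)
qed

text \<open>
  Expanding the square and inserting the sector condition leaves \<open>\<parallel>\<nabla>f y\<parallel>\<^sup>2\<close> with the coefficient
  \<open>\<gamma> (\<gamma> - 2/(l + \<alpha>))\<close>. The step-size bound makes it nonpositive, so the lower gradient bound
  \<open>\<parallel>\<nabla>f y\<parallel> \<ge> \<alpha> \<parallel>y - z\<parallel>\<close> can be used there, which completes the square \<open>(1 - \<gamma> \<alpha>)\<^sup>2\<close>.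
\<close>

lemma gradient_step_contraction:
  fixes f :: "'a::euclidean_space \<Rightarrow> real"
  assumes sc: "strongly_convex \<alpha> f" and sm: "smooth l f" and min: "is_minimizer f z"
    and \<gamma>: "0 < \<gamma>" "\<gamma> \<le> 2 / (l + \<alpha>)"
  shows "norm (y - \<gamma> *\<^sub>R gradient f y - z) \<le> (1 - \<gamma> * \<alpha>) * norm (y - z)"
    and "0 \<le> 1 - \<gamma> * \<alpha>" "1 - \<gamma> * \<alpha> < 1"
proof -
  note al = curvature_order[OF sc sm]
  have \<gamma>': "\<gamma> * (l + \<alpha>) \<le> 2" using \<gamma> al by (simp add: pos_le_divide_eq)
  have "\<gamma> * (2 * \<alpha>) \<le> \<gamma> * (l + \<alpha>)" using al \<gamma> by (intro mult_left_mono) auto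
  then show nn: "0 \<le> 1 - \<gamma> * \<alpha>" using \<gamma>' by (simp add: mult.assoc)
  show "1 - \<gamma> * \<alpha> < 1" using al \<gamma> by simp
  define G where "G = gradient f y"
  define w where "w = y - z"
  have sec: "\<alpha> * l * (norm w)\<^sup>2 + (norm G)\<^sup>2 \<le> (l + \<alpha>) * (G \<bullet> w)"
    using gradient_sector[OF sc sm min, of y] by (simp add: G_def w_def)
  have low: "\<alpha>\<^sup>2 * (norm w)\<^sup>2 \<le> (norm G)\<^sup>2"
    using gradient_norm_bounds(1)[OF sc sm min, of y] al
    by (metis G_def w_def less_imp_le mult_nonneg_nonneg norm_ge_zero power_mono power_mult_distrib)
  have "(l + \<alpha>) * (norm (w - \<gamma> *\<^sub>R G))\<^sup>2
      = (l + \<alpha>) * (norm w)\<^sup>2 - 2 * \<gamma> * ((l + \<alpha>) * (G \<bullet> w)) + (l + \<alpha>) * \<gamma>\<^sup>2 * (norm G)\<^sup>2"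
    unfolding power2_norm_eq_inner
    by (simp add: inner_diff_left inner_diff_right inner_commute power2_eq_square algebra_simps)
  also have "\<dots> \<le> (l + \<alpha>) * (norm w)\<^sup>2 - 2 * \<gamma> * (\<alpha> * l * (norm w)\<^sup>2 + (norm G)\<^sup>2)
      + (l + \<alpha>) * \<gamma>\<^sup>2 * (norm G)\<^sup>2"
    using sec \<gamma> by simp
  also have "\<dots> = (l + \<alpha>) * (norm w)\<^sup>2 - 2 * \<gamma> * \<alpha> * l * (norm w)\<^sup>2
      - \<gamma> * (2 - \<gamma> * (l + \<alpha>)) * (norm G)\<^sup>2"
    by (simp add: power2_eq_square algebra_simps)
  also have "\<dots> \<le> (l + \<alpha>) * (norm w)\<^sup>2 - 2 * \<gamma> * \<alpha> * l * (norm w)\<^sup>2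
      - \<gamma> * (2 - \<gamma> * (l + \<alpha>)) * (\<alpha>\<^sup>2 * (norm w)\<^sup>2)"
    using low \<gamma> \<gamma>' by (intro diff_left_mono mult_left_mono) auto
  also have "\<dots> = (l + \<alpha>) * ((1 - \<gamma> * \<alpha>) * norm w)\<^sup>2"
    by (simp add: power2_eq_square algebra_simps)
  finally have "(norm (w - \<gamma> *\<^sub>R G))\<^sup>2 \<le> ((1 - \<gamma> * \<alpha>) * norm w)\<^sup>2"
    using al by (simp add: mult_le_cancel_left_pos)
  then have "norm (w - \<gamma> *\<^sub>R G) \<le> (1 - \<gamma> * \<alpha>) * norm w"
    by (rule power2_le_imp_le) (intro mult_nonneg_nonneg nn norm_ge_zero)
  then show "norm (y - \<gamma> *\<^sub>R gradient f y - z) \<le> (1 - \<gamma> * \<alpha>) * norm (y - z)"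
    by (simp add: w_def G_def algebra_simps)
qed

section \<open>Bounded sequences with vanishing mean\<close>

text \<open>
  Boundedness is part of the notion because the regret is quadratic in the errors: for a bounded sequence,
  sublinear sums of norms give sublinear sums of squares.
\<close>

definition vanishing_mean :: "(nat \<Rightarrow> 'a::real_normed_vector) \<Rightarrow> bool" where
  "vanishing_mean z \<longleftrightarrow> Bseq z \<and> sublinear (\<lambda>T. \<Sum>t=1..T. norm (z t))"

lemma sublinear_dominated:
  assumes "sublinear q" and "\<And>T. 0 \<le> p T" "\<And>T. p T \<le> C + K * q T"
  shows "sublinear p"
  unfolding sublinear_def
proof (rule tendsto_sandwich[where f = "\<lambda>_. 0" and h = "\<lambda>T. C * (1 / real T) + K * (q T / real T)"])
  have "(\<lambda>T. C * (1 / real T) + K * (q T / real T)) \<longlonglongrightarrow> C * 0 + K * 0"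
    using assms(1) lim_1_over_n unfolding sublinear_def by (intro tendsto_intros)
  then show "(\<lambda>T. C * (1 / real T) + K * (q T / real T)) \<longlonglongrightarrow> 0" by simp
  show "\<forall>\<^sub>F T in sequentially. 0 \<le> p T / real T" using assms(2) by simp
  show "\<forall>\<^sub>F T in sequentially. p T / real T \<le> C * (1 / real T) + K * (q T / real T)"
  proof (intro always_eventually allI)
    fix T
    have "p T / real T \<le> (C + K * q T) / real T" using assms(3) by (intro divide_right_mono) auto
    then show "p T / real T \<le> C * (1 / real T) + K * (q T / real T)"
      by (simp add: add_divide_distrib)
  qed
qed simp

lemma sublinear_add: "sublinear p \<Longrightarrow> sublinear q \<Longrightarrow> sublinear (\<lambda>T. p T + q T)"
  unfolding sublinear_def using tendsto_add[of "\<lambda>T. p T / real T" 0 _ "\<lambda>T. q T / real T" 0]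
  by (simp add: add_divide_distrib)

lemma sublinear_cmult: "sublinear q \<Longrightarrow> sublinear (\<lambda>T. c * q T)"
  unfolding sublinear_def using tendsto_mult_left[of "\<lambda>T. q T / real T" 0 _ c] by simp

lemma sublinear_Suc:
  assumes "sublinear q" shows "sublinear (\<lambda>T. q (Suc T))"
proof -
  have "(\<lambda>T. q (Suc T) / real (Suc T)) \<longlonglongrightarrow> 0"
    using assms unfolding sublinear_def by (rule LIMSEQ_Suc)
  then have "(\<lambda>T. q (Suc T) / real (Suc T) * (1 + 1 / real T)) \<longlonglongrightarrow> 0 * (1 + 0)"
    using lim_1_over_n by (intro tendsto_intros)
  then have *: "(\<lambda>T. q (Suc T) / real (Suc T) * (1 + 1 / real T)) \<longlonglongrightarrow> 0" by simp
  show ?thesis unfolding sublinear_def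
    by (rule Lim_transform_eventually[OF *])
      (use eventually_gt_at_top[of "0::nat"] in eventually_elim, simp add: divide_simps)
qed

lemma vanishing_mean_dominated:
  assumes z: "vanishing_mean z" and le: "\<And>t. t \<ge> 1 \<Longrightarrow> norm (w t) \<le> C * norm (z t)"
  shows "vanishing_mean w"
proof -
  have "sublinear (\<lambda>T. \<Sum>t=1..T. norm (w t))"
  proof (rule sublinear_dominated)
    show "sublinear (\<lambda>T. \<Sum>t=1..T. norm (z t))" using z by (simp add: vanishing_mean_def)
    show "(\<Sum>t=1..T. norm (w t)) \<le> 0 + C * (\<Sum>t=1..T. norm (z t))" for T
      unfolding sum_distrib_left by (simp only: add_0_left, intro sum_mono le) simp
  qed (simp add: sum_nonneg)
  moreover have "Bseq w"
  proof -
    obtain K where K: "\<And>t. norm (z t) \<le> K"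
      using z unfolding vanishing_mean_def Bseq_def by blast
    have "norm (w (Suc t)) \<le> \<bar>C\<bar> * K" for t
    proof -
      have "norm (w (Suc t)) \<le> C * norm (z (Suc t))" by (simp add: le)
      also have "\<dots> \<le> \<bar>C\<bar> * norm (z (Suc t))" by (intro mult_right_mono) auto
      also have "\<dots> \<le> \<bar>C\<bar> * K" using K by (intro mult_left_mono) auto
      finally show ?thesis .
    qed
    then have "Bseq (\<lambda>t. w (Suc t))" by (rule BseqI')
    then show ?thesis by (simp add: Bseq_Suc_iff)
  qed
  ultimately show ?thesis by (simp add: vanishing_mean_def)
qed

lemma vanishing_mean_cong:
  assumes "vanishing_mean z" "\<And>t. t \<ge> 1 \<Longrightarrow> w t = z t"
  shows "vanishing_mean w"
  by (rule vanishing_mean_dominated[OF assms(1), where C = 1]) (simp add: assms(2))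

lemma vanishing_mean_add:
  assumes z: "vanishing_mean z" and w: "vanishing_mean w"
  shows "vanishing_mean (\<lambda>t. z t + w t)"
proof -
  have "sublinear (\<lambda>T. \<Sum>t=1..T. norm (z t + w t))"
  proof (rule sublinear_dominated)
    show "sublinear (\<lambda>T. (\<Sum>t=1..T. norm (z t)) + (\<Sum>t=1..T. norm (w t)))"
      using z w by (intro sublinear_add) (simp_all add: vanishing_mean_def)
    show "(\<Sum>t=1..T. norm (z t + w t)) \<le> 0 + 1 * ((\<Sum>t=1..T. norm (z t)) + (\<Sum>t=1..T. norm (w t)))" for T
      by (simp add: sum.distrib[symmetric] sum_mono norm_triangle_ineq)
  qed (simp add: sum_nonneg)
  moreover have "Bseq (\<lambda>t. z t + w t)"
  proof -
    obtain K1 where K1: "\<And>t. norm (z t) \<le> K1"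
      using z unfolding vanishing_mean_def Bseq_def by blast
    obtain K2 where K2: "\<And>t. norm (w t) \<le> K2"
      using w unfolding vanishing_mean_def Bseq_def by blast
    show ?thesis
      by (rule BseqI'[where K = "K1 + K2"]) (rule norm_triangle_mono[OF K1 K2])
  qed
  ultimately show ?thesis by (simp add: vanishing_mean_def)
qed

lemma vanishing_mean_linear:
  fixes f :: "'a::euclidean_space \<Rightarrow> 'b::real_normed_vector"
  assumes "linear f" "vanishing_mean z"
  shows "vanishing_mean (\<lambda>t. f (z t))"
proof -
  obtain K where "\<And>y. norm (f y) \<le> K * norm y" using linear_bounded[OF assms(1)] by blast
  then show ?thesis by (intro vanishing_mean_dominated[OF assms(2)]) auto
qed

lemma vanishing_mean_diff:
  fixes z w :: "nat \<Rightarrow> 'a::real_normed_vector"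
  assumes "vanishing_mean z" "vanishing_mean w"
  shows "vanishing_mean (\<lambda>t. z t - w t)"
  using vanishing_mean_add[OF assms(1) vanishing_mean_dominated[OF assms(2), of "\<lambda>t. - w t" 1]]
  by simp

lemma vanishing_mean_sum:
  assumes "finite I" "\<And>i. i \<in> I \<Longrightarrow> vanishing_mean (z i)"
  shows "vanishing_mean (\<lambda>t. \<Sum>i\<in>I. z i t)"
  using assms
proof (induction I)
  case empty
  then show ?case by (simp add: vanishing_mean_def sublinear_def)
qed (simp add: vanishing_mean_add)

lemma vanishing_mean_Suc_iff: "vanishing_mean (\<lambda>t. z (Suc t)) \<longleftrightarrow> vanishing_mean z"
proof -
  have eq: "(\<Sum>t=1..Suc T. norm (z t)) = norm (z 1) + (\<Sum>t=1..T. norm (z (Suc t)))" for T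
    by (induction T) auto
  have "sublinear (\<lambda>T. \<Sum>t=1..T. norm (z (Suc t)))" if "sublinear (\<lambda>T. \<Sum>t=1..T. norm (z t))"
  proof (rule sublinear_dominated[OF sublinear_Suc[OF that]])
    show "(\<Sum>t=1..T. norm (z (Suc t))) \<le> 0 + 1 * (\<Sum>t=1..Suc T. norm (z t))" for T
      unfolding eq by simp
  qed (simp add: sum_nonneg)
  moreover have "sublinear (\<lambda>T. \<Sum>t=1..T. norm (z t))"
    if "sublinear (\<lambda>T. \<Sum>t=1..T. norm (z (Suc t)))"
  proof (rule sublinear_dominated[OF that])
    show "(\<Sum>t=1..T. norm (z t)) \<le> norm (z 1) + 1 * (\<Sum>t=1..T. norm (z (Suc t)))" for T
    proof -
      have "(\<Sum>t=1..Suc T. norm (z t)) = (\<Sum>t=1..T. norm (z t)) + norm (z (Suc T))" by simp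
      then show ?thesis using eq[of T] norm_ge_zero[of "z (Suc T)"] by linarith
    qed
  qed (simp add: sum_nonneg)
  ultimately show ?thesis by (auto simp: vanishing_mean_def Bseq_Suc_iff)
qed

lemma vanishing_mean_delay:
  assumes "vanishing_mean z" shows "vanishing_mean (\<lambda>t. z (t - i))"
proof (induction i)
  case (Suc i)
  then have "vanishing_mean (\<lambda>t. z (Suc t - Suc i))" by simp
  then show ?case by (subst (asm) vanishing_mean_Suc_iff)
qed (simp add: assms)

text \<open>
  Summing the recursion over time, the left-hand side telescopes up to the factor \<open>1 - \<rho>\<close>, so the sum of the
  state norms, times \<open>1 - \<rho>\<close>, is at most the initial norm plus the sum of the forcing norms.
\<close>

lemma vanishing_mean_contraction:
  assumes \<rho>: "0 \<le> \<rho>" "\<rho> < 1" and d: "vanishing_mean d"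
    and step: "\<And>t. t \<ge> 1 \<Longrightarrow> norm (z (Suc t)) \<le> \<rho> * norm (z t) + norm (d t)"
  shows "vanishing_mean z"
proof -
  have energy: "(1 - \<rho>) * (\<Sum>t=1..T. norm (z t)) + norm (z (Suc T))
      \<le> norm (z 1) + (\<Sum>t=1..T. norm (d t))" for T
  proof (induction T)
    case (Suc T)
    then show ?case using step[of "Suc T"] by (simp add: algebra_simps)
  qed simp
  have "sublinear (\<lambda>T. \<Sum>t=1..T. norm (z t))"
  proof (rule sublinear_dominated)
    show "sublinear (\<lambda>T. \<Sum>t=1..T. norm (d t))" using d by (simp add: vanishing_mean_def)
    show "(\<Sum>t=1..T. norm (z t)) \<le> norm (z 1) / (1 - \<rho>) + 1 / (1 - \<rho>) * (\<Sum>t=1..T. norm (d t))" for T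
    proof -
      have "(1 - \<rho>) * (\<Sum>t=1..T. norm (z t)) \<le> norm (z 1) + (\<Sum>t=1..T. norm (d t))"
        using energy[of T] norm_ge_zero[of "z (Suc T)"] by linarith
      then show ?thesis using \<rho>
        by (simp add: add_divide_distrib[symmetric] pos_le_divide_eq mult.commute)
    qed
  qed (simp add: sum_nonneg)
  moreover have "Bseq z"
  proof -
    obtain K where K: "\<And>t. norm (d t) \<le> K"
      using d unfolding vanishing_mean_def Bseq_def by blast
    \<comment> \<open>The interval \<open>[0, M]\<close> is mapped into itself by \<open>r \<mapsto> \<rho> r + K\<close>, as \<open>M\<close> is at least the fixed point.\<close>
    define M where "M = norm (z 1) + K / (1 - \<rho>)"
    have K0: "0 \<le> K" using K[of 0] norm_ge_zero order_trans by blast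
    have "norm (z (Suc t)) \<le> M" for t
    proof (induction t)
      case 0
      then show ?case using K0 \<rho> by (simp add: M_def)
    next
      case (Suc t)
      have "norm (z (Suc (Suc t))) \<le> \<rho> * M + K"
        using step[of "Suc t"] K[of "Suc t"] mult_left_mono[OF Suc \<rho>(1)] by simp
      moreover have "(1 - \<rho>) * M \<ge> K"
        using \<rho> by (simp add: M_def distrib_left)
      ultimately show ?case by (simp add: algebra_simps)
    qed
    then have "Bseq (\<lambda>t. z (Suc t))" by (rule BseqI')
    then show ?thesis by (simp add: Bseq_Suc_iff)
  qed
  ultimately show ?thesis by (simp add: vanishing_mean_def)
qed

lemma sublinear_sum_square:
  assumes "vanishing_mean z"
  shows "sublinear (\<lambda>T. \<Sum>t=1..T. (norm (z t))\<^sup>2)"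
proof -
  obtain K where K: "\<And>t. norm (z t) \<le> K"
    using assms unfolding vanishing_mean_def Bseq_def by blast
  show ?thesis
  proof (rule sublinear_dominated)
    show "sublinear (\<lambda>T. \<Sum>t=1..T. norm (z t))" using assms by (simp add: vanishing_mean_def)
    show "(\<Sum>t=1..T. (norm (z t))\<^sup>2) \<le> 0 + K * (\<Sum>t=1..T. norm (z t))" for T
      unfolding sum_distrib_left power2_eq_square
      using K by (simp add: sum_mono mult_right_mono)
  qed (simp add: sum_nonneg)
qed

lemma vanishing_mean_increments:
  fixes z :: "nat \<Rightarrow> 'a::real_normed_vector"
  assumes "compact D" "\<And>t. z t \<in> D"
    and "sublinear q" "\<And>T. (\<Sum>t=1..T. norm (z t - z (t - 1))) \<le> q T"
  shows "vanishing_mean (\<lambda>t. z (Suc t) - z t)"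
proof -
  obtain K where K: "\<And>t. norm (z t) \<le> K"
    using compact_imp_bounded[OF assms(1)] assms(2) unfolding bounded_iff by blast
  have "Bseq (\<lambda>t. z t - z (t - 1))"
    by (rule BseqI'[where K = "K + K"]) (intro norm_triangle_le_diff add_mono K)
  moreover have "sublinear (\<lambda>T. \<Sum>t=1..T. norm (z t - z (t - 1)))"
    by (rule sublinear_dominated[OF assms(3), where C = 0 and K = 1])
      (use assms(4) in \<open>auto simp: sum_nonneg\<close>)
  ultimately have "vanishing_mean (\<lambda>t. z t - z (t - 1))" by (simp add: vanishing_mean_def)
  then show ?thesis using vanishing_mean_Suc_iff[of "\<lambda>t. z t - z (t - 1)"] by simp
qed

section \<open>Block structure of the planned inputs\<close>

text \<open>
  Indexing the blocks by numbers instead of elements of \<open>'k\<close> turns the action of the controllability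
  matrix into the sum \<open>\<Sum>j<\<mu>. A\<^sup>j B U\<^sub>j\<close> and the action of \<open>W\<close> into an index shift. So block \<open>j\<close> of a plan is the
  input that is followed by exactly \<open>j\<close> further steps of the horizon.
\<close>

definition block :: "real^('k::{finite,linorder} \<times> 'm::finite) \<Rightarrow> nat \<Rightarrow> real^'m" where
  "block U j = (\<chi> c. if j < CARD('k) then U $ (inv (blk :: 'k \<Rightarrow> nat) j, c) else 0)"

lemma block_blk:
  fixes U :: "real^('k::{finite,linorder} \<times> 'm::finite)"
  shows "block U (blk k) = (\<chi> c. U $ (k, c))"
  using bij_betw_blk[where 'k = 'k]
  by (auto simp: block_def bij_betw_def vec_eq_iff)

lemma blk_surj:
  assumes "j < CARD('k)" obtains k :: "'k::{finite,linorder}" where "blk k = j"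
  using assms bij_betw_blk[where 'k = 'k] by (auto simp: bij_betw_def) (metis imageE lessThan_iff)

lemma matpow_commute: "matpow A k ** A = A ** matpow (A :: real^'n^'n) k"
  by (induction k) (simp_all add: matrix_mul_assoc[symmetric])

lemma ctrl_mat_mult:
  fixes U :: "real^('k::{finite,linorder} \<times> 'm::finite)"
  shows "ctrl_mat A B *v U = (\<Sum>j<CARD('k). matpow A j *v (B *v block U j))"
proof -
  have "ctrl_mat A B *v U = (\<Sum>k\<in>UNIV. matpow A (blk k) *v (B *v block U (blk (k::'k))))"
    unfolding block_blk matrix_vector_mul_assoc
  proof (subst vec_eq_iff, intro allI)
    fix i
    have "(ctrl_mat A B *v U) $ i
        = (\<Sum>(k, c)\<in>UNIV \<times> UNIV. (matpow A (blk k) ** B) $ i $ c * U $ (k, c))"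
      unfolding matrix_vector_mult_def ctrl_mat_def by (simp add: split_def)
    also have "\<dots> = (\<Sum>k\<in>UNIV. \<Sum>c\<in>UNIV. (matpow A (blk k) ** B) $ i $ c * U $ (k, c))"
      by (rule sum.cartesian_product[symmetric])
    also have "\<dots> = (\<Sum>k\<in>UNIV. (matpow A (blk k) ** B) *v (\<chi> c. U $ (k, c))) $ i"
      by (simp add: matrix_vector_mult_def[of _ "\<chi> c. U $ (_, c)"])
    finally show "(ctrl_mat A B *v U) $ i
        = (\<Sum>k\<in>UNIV. (matpow A (blk k) ** B) *v (\<chi> c. U $ (k, c))) $ i" .
  qed
  also have "\<dots> = (\<Sum>j<CARD('k). matpow A j *v (B *v block U j))"
    by (rule sum.reindex_bij_betw[OF bij_betw_blk])
  finally show ?thesis .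
qed

lemma block_stack: "j < CARD('k) \<Longrightarrow> block (stack w :: real^('k::{finite,linorder} \<times> 'm::finite)) j = w"
  by (simp add: block_def stack_def vec_eq_iff)

lemma block_W:
  fixes U :: "real^('k::{finite,linorder} \<times> 'm::finite)"
  assumes "j < CARD('k)"
  shows "block (W_mat *v U) j = (case j of 0 \<Rightarrow> 0 | Suc i \<Rightarrow> block U i)"
proof -
  obtain k :: 'k where k: "blk k = j" using blk_surj[OF assms] .
  have "(W_mat *v U) $ (k, c) = (case j of 0 \<Rightarrow> 0 | Suc i \<Rightarrow> block U i) $ c" for c
  proof (cases j)
    case 0
    then show ?thesis using k by (simp add: matrix_vector_mult_def W_mat_def)
  next
    case (Suc i)
    have "i < CARD('k)" using assms Suc by simp
    then obtain k' :: 'k where k': "blk k' = i" by (rule blk_surj)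
    have inj: "i = blk q \<longleftrightarrow> q = k'" for q :: 'k
      using k' bij_betw_blk[where 'k = 'k] by (auto simp: bij_betw_def inj_def)
    have "(W_mat *v U) $ (k, c) = (\<Sum>q\<in>UNIV. if q = (k', c) then U $ q else 0)"
    proof -
      have "W_mat $ (k, c) $ q * U $ q = (if q = (k', c) then U $ q else 0)" for q
        by (cases q) (auto simp: W_mat_def k Suc inj)
      then show ?thesis by (simp only: matrix_vector_mult_def vec_lambda_beta)
    qed
    also have "\<dots> = U $ (k', c)" by simp
    also have "\<dots> = block U i $ c" using block_blk[of U k'] k' by simp
    finally show ?thesis using Suc by simp
  qed
  then show ?thesis unfolding k[symmetric] block_blk by (simp add: vec_eq_iff)
qed

lemma e_mult: "e_mat *v (U :: real^('k::{finite,linorder} \<times> 'm::finite)) = block U (CARD('k) - 1)"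
proof -
  obtain n where n: "CARD('k) = Suc n" using not0_implies_Suc by fastforce
  then have "n < CARD('k)" by simp
  then obtain k' :: 'k where k': "blk k' = n" by (rule blk_surj)
  have inj: "blk q = n \<longleftrightarrow> q = k'" for q :: 'k
    using k' bij_betw_blk[where 'k = 'k] unfolding bij_betw_def inj_def by metis
  have "(e_mat *v U) $ c = block U n $ c" for c
  proof -
    have "(e_mat *v U) $ c = (\<Sum>q\<in>UNIV. if q = (k', c) then U $ q else 0)"
    proof -
      have "e_mat $ c $ q * U $ q = (if q = (k', c) then U $ q else 0)" for q
        by (cases q) (auto simp: e_mat_def n inj)
      then show ?thesis by (simp only: matrix_vector_mult_def vec_lambda_beta)
    qed
    also have "\<dots> = U $ (k', c)" by simp
    also have "\<dots> = block U n $ c" using block_blk[of U k'] k' by simp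
    finally show ?thesis .
  qed
  then show ?thesis by (simp add: vec_eq_iff n)
qed

lemma block_W_pow:
  fixes U :: "real^('k::{finite,linorder} \<times> 'm::finite)"
  assumes "j < CARD('k)" "j < i"
  shows "block (matpow W_mat i *v U) j = 0"
  using assms
proof (induction i arbitrary: j)
  case (Suc i)
  then show ?case
    by (simp add: matrix_vector_mul_assoc[symmetric] block_W split: nat.split)
qed simp

text \<open>After \<open>\<mu>\<close> shifts every planned block has left the horizon.\<close>

lemma ctrl_mat_W_nilpotent:
  fixes U :: "real^('k::{finite,linorder} \<times> 'm::finite)"
  shows "ctrl_mat A B *v (matpow W_mat CARD('k) *v U) = 0"
  by (simp add: ctrl_mat_mult block_W_pow)

text \<open>
  One more step of the system raises every power of \<open>A\<close> in the plan by one. All blocks but the last stay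
  within the horizon and form the shifted plan; the last one, selected by \<open>e\<close>, is the input to be
  applied now and joins the current state under \<open>A\<^sup>\<mu>\<close>.
\<close>

lemma plan_shift:
  fixes U :: "real^('k::{finite,linorder} \<times> 'm::finite)"
  shows "A *v (ctrl_mat A B *v U)
    = ctrl_mat A B *v (W_mat *v U) + matpow A CARD('k) *v (B *v (e_mat *v U))"
proof -
  obtain n where n: "CARD('k) = Suc n" using not0_implies_Suc by fastforce
  have "A *v (ctrl_mat A B *v U) = (\<Sum>j<Suc n. matpow A (Suc j) *v (B *v block U j))"
    by (simp add: ctrl_mat_mult n linear_sum[OF matrix_vector_mul_linear]
        matrix_vector_mul_assoc matrix_mul_assoc matrix_vector_right_distrib del: sum.lessThan_Suc)
  also have "\<dots> = (\<Sum>j<n. matpow A (Suc j) *v (B *v block U j)) + matpow A (Suc n) *v (B *v block U n)"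
    by simp
  also have "(\<Sum>j<n. matpow A (Suc j) *v (B *v block U j)) = ctrl_mat A B *v (W_mat *v U)"
    unfolding ctrl_mat_mult n sum.lessThan_Suc_shift
    by (simp add: block_W n)
  finally show ?thesis by (simp add: e_mult n)
qed

text \<open>Shifting a constant plan empties its block 0 and changes nothing else.\<close>

lemma ctrl_mat_stack_shift:
  "ctrl_mat A B *v (stack w :: real^('k::{finite,linorder} \<times> 'm::finite))
    = ctrl_mat A B *v (W_mat *v (stack w :: real^('k \<times> 'm))) + B *v w"
proof -
  obtain n where n: "CARD('k) = Suc n" using not0_implies_Suc by fastforce
  show ?thesis
    unfolding ctrl_mat_mult n sum.lessThan_Suc_shift
    by (simp add: block_W block_stack n)
qed

lemma linear_stack: "linear (stack :: real^'m::finite \<Rightarrow> real^('k::{finite,linorder} \<times> 'm))"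
  by (rule linearI) (simp_all add: stack_def vec_eq_iff)

text \<open>Holding the equilibrium input over the whole horizon keeps the system at the equilibrium.\<close>

lemma equilibrium_iterate:
  fixes A :: "real^'n^'n" and \<eta> :: "real^'m::finite"
  assumes eq: "\<theta> = A *v \<theta> + B *v \<eta>"
  shows "\<theta> = matpow A CARD('k) *v \<theta> + ctrl_mat A B *v (stack \<eta> :: real^('k::{finite,linorder} \<times> 'm))"
proof -
  have "\<theta> = matpow A k *v \<theta> + (\<Sum>j<k. matpow A j *v (B *v \<eta>))" for k
  proof (induction k)
    case (Suc k)
    have "matpow A k *v \<theta> = matpow A k *v (A *v \<theta>) + matpow A k *v (B *v \<eta>)"
      using arg_cong[OF eq, of "\<lambda>y. matpow A k *v y"] by (simp add: matrix_vector_right_distrib)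
    then show ?case using Suc by (simp add: matrix_vector_mul_assoc matpow_commute ac_simps)
  qed simp
  from this[of "CARD('k)"] show ?thesis by (simp add: ctrl_mat_mult block_stack)
qed

text \<open>
  If \<open>S S\<^sup>T y = 0\<close> then \<open>\<parallel>S\<^sup>T y\<parallel>\<^sup>2 = 0\<close>, and \<open>S\<^sup>T\<close> is injective when \<open>S\<close> has full row rank; so \<open>S S\<^sup>T\<close> is
  invertible.
\<close>

lemma full_row_rank_right_inverse:
  fixes S :: "real^'k::finite^'n"
  assumes "rank S = CARD('n)"
  shows "S ** (transpose S ** matrix_inv (S ** transpose S)) = mat 1"
proof -
  have inj: "inj ((*v) (transpose S))"
    using assms by (simp add: full_rank_injective[symmetric] rank_transpose)
  have "y = 0" if "(S ** transpose S) *v y = 0" for y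
  proof -
    have "S *v (transpose S *v y) = 0" using that by (simp only: matrix_vector_mul_assoc)
    then have "(transpose S *v y) \<bullet> (transpose S *v y) = 0"
      by (metis dot_lmul_matrix transpose_matrix_vector inner_zero_right)
    then have "transpose S *v y = transpose S *v 0" by simp
    then show "y = 0" using inj by (metis injD)
  qed
  then have "invertible (S ** transpose S)"
    using invertible_left_inverse matrix_left_invertible_ker by blast
  then have "(S ** transpose S) ** matrix_inv (S ** transpose S) = mat 1"
    unfolding invertible_def matrix_inv_def by (rule someI2_ex) simp
  then show ?thesis by (simp add: matrix_mul_assoc)
qed

section \<open>The closed loop\<close>

text \<open>
  If \<open>A\<^sup>k\<^sup>+\<^sup>1 \<xi>\<^sub>t\<close> has vanishing mean, then so does \<open>A\<^sup>k \<xi>\<^sub>t\<^sub>+\<^sub>1 = A\<^sup>k\<^sup>+\<^sup>1 \<xi>\<^sub>t + A\<^sup>k w\<^sub>t\<close>, and shifting time back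
  does not affect this. Iterating down to \<open>k = 0\<close> yields \<open>\<xi>\<close> itself, whatever the size of \<open>A\<close>.
\<close>

lemma vanishing_mean_deadbeat:
  fixes A :: "real^'n^'n"
  assumes w: "vanishing_mean w" and step: "\<And>t. t \<ge> 1 \<Longrightarrow> \<xi> (Suc t) = A *v \<xi> t + w t"
    and "vanishing_mean (\<lambda>t. matpow A k *v \<xi> t)"
  shows "vanishing_mean \<xi>"
  using assms(3)
proof (induction k)
  case (Suc k)
  have "vanishing_mean (\<lambda>t. matpow A k *v w t)"
    by (rule vanishing_mean_linear[OF matrix_vector_mul_linear w])
  from vanishing_mean_add[OF Suc.prems this]
  have "vanishing_mean (\<lambda>t. matpow A k *v \<xi> (Suc t))"
    by (rule vanishing_mean_cong)
      (simp add: step matrix_vector_right_distrib matrix_vector_mul_assoc matpow_commute)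
  then show ?case using Suc.IH vanishing_mean_Suc_iff[of "\<lambda>t. matpow A k *v \<xi> t"] by blast
qed simp

text \<open>
  The term \<open>y - \<gamma>\<^sub>x \<nabla>f(y)\<close> is the prediction \<open>y\<close> corrected by the new input correction \<open>g\<^sub>t\<close>, as \<open>g\<^sub>t\<close> is a right
  inverse of \<open>S\<close> applied to the desired displacement. It is the state to which the current plan
  \<open>stack v\<^sub>t + P\<close> leads. Applying \<open>A\<close> and \<open>plan_shift\<close> exposes \<open>A\<^sup>\<mu> x\<^sub>t\<close> together with the shifted
  plan, from which the next prediction differs only by the nominal input that enters block 0 and by
  the change from \<open>v\<^sub>t\<close> to \<open>v\<^sub>t\<^sub>+\<^sub>1\<close>.
\<close>

lemma prediction_recursion:
  fixes A :: "real^'n^'n" and B :: "real^'m::finite^'n"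
    and g :: "nat \<Rightarrow> real^('k::{finite,linorder} \<times> 'm)"
  assumes alg: "algorithm1 A B \<gamma>\<^sub>v \<gamma>\<^sub>x fx fu x u v xhat g"
    and rank: "rank (ctrl_mat A B :: real^('k \<times> 'm)^'n) = CARD('n)" and t: "t \<ge> 1"
  defines "y \<equiv> xhat (t + CARD('k) - 1)"
  shows "xhat (Suc t + CARD('k) - 1) = A *v (y - \<gamma>\<^sub>x *\<^sub>R gradient (fx (t - 1)) y) + B *v v t
    + (ctrl_mat A B :: real^('k \<times> 'm)^'n) *v stack (v (Suc t) - v t)"
proof -
  obtain n where n: "CARD('k) = Suc n" using not0_implies_Suc by fastforce
  define S where "S = (ctrl_mat A B :: real^('k \<times> 'm)^'n)"
  define P where "P = (\<Sum>i=0..n. matpow W_mat i *v g (t - i))"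
  note alg' = alg[unfolded algorithm1_def Let_def n, folded S_def, THEN conjunct2, rule_format]
  have g: "S *v g t = - \<gamma>\<^sub>x *\<^sub>R gradient (fx (t - 1)) y"
    using alg'[OF t] full_row_rank_right_inverse[OF rank, folded S_def]
    by (simp add: matrix_vector_mult_scaleR matrix_vector_mul_assoc y_def n
        linear_neg[OF matrix_vector_mul_linear])
  have P: "P = g t + (\<Sum>i=1..n. matpow W_mat i *v g (t - i))"
    unfolding P_def by (subst sum.atLeast_Suc_atMost) auto
  have y: "y = matpow A (Suc n) *v x (t - 1) + S *v stack (v t)
      + S *v (\<Sum>i=1..n. matpow W_mat i *v g (t - i))"
    using alg'[OF t] by (simp add: y_def n)
  have ahead: "y - \<gamma>\<^sub>x *\<^sub>R gradient (fx (t - 1)) y = matpow A (Suc n) *v x (t - 1) + S *v (stack (v t) + P)"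
  proof -
    have "y + S *v g t = matpow A (Suc n) *v x (t - 1) + S *v (stack (v t) + P)"
      unfolding P by (subst y) (simp only: matrix_vector_right_distrib ac_simps)
    then show ?thesis using g by simp
  qed
  have ut: "u t = e_mat *v (stack (v t) + P)"
  proof -
    have "u t = v t + (\<Sum>i=0..n. (e_mat ** matpow W_mat i) *v g (t - i))"
      using alg'[OF t] by simp
    moreover have "e_mat *v (stack (v t) :: real^('k \<times> 'm)) = v t"
      by (simp add: e_mult block_stack)
    ultimately show ?thesis
      by (simp only: matrix_vector_right_distrib P_def linear_sum[OF matrix_vector_mul_linear]
          matrix_vector_mul_assoc)
  qed
  have xt: "x t = A *v x (t - 1) + B *v u t" using alg'[OF t] by simp
  have WP: "S *v (W_mat *v P) = S *v (\<Sum>i=1..n. matpow W_mat i *v g (Suc t - i))"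
  proof -
    have "W_mat *v P = (\<Sum>i=0..n. matpow W_mat (Suc i) *v g (Suc t - Suc i))"
      by (simp add: P_def linear_sum[OF matrix_vector_mul_linear] matrix_vector_mul_assoc)
    also have "\<dots> = (\<Sum>i=Suc 0..Suc n. matpow W_mat i *v g (Suc t - i))"
      by (rule sum.shift_bounds_cl_Suc_ivl[symmetric])
    also have "\<dots> = (\<Sum>i=1..n. matpow W_mat i *v g (Suc t - i))
        + matpow W_mat CARD('k) *v g (Suc t - Suc n)"
      by (simp add: n)
    finally show ?thesis
      unfolding S_def by (simp add: matrix_vector_right_distrib ctrl_mat_W_nilpotent)
  qed
  have "A *v (y - \<gamma>\<^sub>x *\<^sub>R gradient (fx (t - 1)) y)
      = matpow A (Suc n) *v (A *v x (t - 1)) + A *v (S *v (stack (v t) + P))"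
    unfolding ahead
    by (simp add: matrix_vector_right_distrib matrix_vector_mul_assoc matpow_commute
        matrix_mul_assoc[symmetric])
  also have "\<dots> = matpow A (Suc n) *v x t + S *v (W_mat *v (stack (v t) + P))"
    unfolding S_def plan_shift by (simp add: n xt ut matrix_vector_right_distrib)
  also have "\<dots> = matpow A (Suc n) *v x t + S *v (W_mat *v stack (v t)) + S *v (W_mat *v P)"
    by (simp add: matrix_vector_right_distrib)
  finally have step: "A *v (y - \<gamma>\<^sub>x *\<^sub>R gradient (fx (t - 1)) y)
      = matpow A (Suc n) *v x t + S *v (W_mat *v stack (v t)) + S *v (W_mat *v P)" .
  have "xhat (Suc t + CARD('k) - 1) = matpow A (Suc n) *v x t + S *v stack (v (Suc t))
      + S *v (W_mat *v P)"
    using alg'[of "Suc t"] by (simp add: n WP)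
  also have "\<dots> = A *v (y - \<gamma>\<^sub>x *\<^sub>R gradient (fx (t - 1)) y) + B *v v t + S *v stack (v (Suc t) - v t)"
    unfolding step linear_diff[OF linear_stack] matrix_vector_mult_diff_distrib[of S]
    using ctrl_mat_stack_shift[of A B "v t", where 'k = 'k, folded S_def] by simp
  finally show ?thesis by (simp add: S_def)
qed

theorem corollary7:
  fixes A :: "real^'n^'n" and B :: "real^'m::finite^'n"
    and L :: "nat \<Rightarrow> real^'n \<Rightarrow> real^'m \<Rightarrow> real"
    and fx :: "nat \<Rightarrow> real^'n \<Rightarrow> real" and fu :: "nat \<Rightarrow> real^'m \<Rightarrow> real"
    and \<alpha>\<^sub>x l\<^sub>x \<alpha>\<^sub>u l\<^sub>u \<gamma>\<^sub>v \<gamma>\<^sub>x :: real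
    and \<theta> :: "nat \<Rightarrow> real^'n" and \<eta> :: "nat \<Rightarrow> real^'m"
    and x xhat :: "nat \<Rightarrow> real^'n" and u v :: "nat \<Rightarrow> real^'m"
    and g :: "nat \<Rightarrow> real^('k::{finite,linorder} \<times> 'm)"
    and xopt :: "nat \<Rightarrow> nat \<Rightarrow> real^'n" and uopt :: "nat \<Rightarrow> nat \<Rightarrow> real^'m"
    and D\<theta> :: "(real^'n) set" and D\<eta> :: "(real^'m) set"
  assumes costs: "cost_assumption \<alpha>\<^sub>x l\<^sub>x \<alpha>\<^sub>u l\<^sub>u L fx fu"
    and theta: "\<And>t. is_minimizer (fx t) (\<theta> t)"
    and eta: "\<And>t. is_minimizer (fu t) (\<eta> t)"
    and steady_state: "\<And>t. t \<ge> 1 \<Longrightarrow> \<theta> t = A *v \<theta> t + B *v \<eta> t"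
    and system: "system_assumption TYPE('k) \<alpha>\<^sub>x l\<^sub>x A B"
    and alpha_u: "\<alpha>\<^sub>u > (2 - sqrt 2) / (2 + sqrt 2) * l\<^sub>u"
    and gamma_v_pos: "\<gamma>\<^sub>v > 0" and gamma_x_pos: "\<gamma>\<^sub>x > 0"
    and gamma_v_lower: "(2 - sqrt 2) / (2 * \<alpha>\<^sub>u) < \<gamma>\<^sub>v"
    and gamma_v_upper: "\<gamma>\<^sub>v \<le> 2 / (l\<^sub>u + \<alpha>\<^sub>u)"
    and gamma_x_lower:
      "A \<noteq> 0 \<Longrightarrow> (2 * spectral_norm A - 1) / (2 * spectral_norm A * \<alpha>\<^sub>x) < \<gamma>\<^sub>x"
    and gamma_x_upper: "\<gamma>\<^sub>x \<le> 2 / (l\<^sub>x + \<alpha>\<^sub>x)"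
    and algorithm: "algorithm1 A B \<gamma>\<^sub>v \<gamma>\<^sub>x fx fu x u v xhat g"
    and eta_0: "\<eta> 0 = v 0"
    and theta_0: "\<theta> 0 = xhat CARD('k)"
    and optimal: "\<And>T. optimal_trajectory A B L (x 0) T (xopt T) (uopt T)"
    and compact_theta: "compact D\<theta>" "\<And>t. \<theta> t \<in> D\<theta>"
    and compact_eta: "compact D\<eta>" "\<And>t. \<eta> t \<in> D\<eta>"
    and path_length:
      "sublinear (\<lambda>T. (\<Sum>t=1..T. norm (\<theta> t - \<theta> (t - 1))) + (\<Sum>t=1..T. norm (\<eta> t - \<eta> (t - 1))))"
  shows "sublinear (\<lambda>T. regret L x u (xopt T) (uopt T) T)"
proof -
  define N where "N = CARD('k)"
  obtain n where n: "N = Suc n" unfolding N_def using not0_implies_Suc by fastforce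
  define S where "S = (ctrl_mat A B :: real^('k \<times> 'm)^'n)"
  have L: "L t y w = fx t y + fu t w"
    and scx: "strongly_convex \<alpha>\<^sub>x (fx t)" and smx: "smooth l\<^sub>x (fx t)"
    and scu: "strongly_convex \<alpha>\<^sub>u (fu t)" and smu: "smooth l\<^sub>u (fu t)" for t y w
    using costs unfolding cost_assumption_def by auto
  have rank: "rank (ctrl_mat A B :: real^('k \<times> 'm)^'n) = CARD('n)"
    using system unfolding system_assumption_def by simp
  note loop = algorithm[unfolded algorithm1_def Let_def, folded N_def S_def, THEN conjunct2, rule_format]
  have v_step: "v (Suc t) = v t - \<gamma>\<^sub>v *\<^sub>R gradient (fu t) (v t)"
    and xhat_eq: "xhat (Suc t + n) = matpow A N *v x t + S *v stack (v (Suc t))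
              + S *v (\<Sum>i=1..n. matpow W_mat i *v g (Suc t - i))"
    and g_eq: "g (Suc t) = - \<gamma>\<^sub>x *\<^sub>R ((transpose S ** matrix_inv (S ** transpose S))
              *v gradient (fx t) (xhat (Suc t + n)))" for t
    using loop[of "Suc t"] by (simp_all add: n)
  have u_eq: "u t = v t + (\<Sum>i=0..n. (e_mat ** matpow W_mat i) *v g (t - i))"
    and x_eq: "x t = A *v x (t - 1) + B *v u t" if "t \<ge> 1" for t
    using loop[OF that] by (simp_all add: n)
  have d\<theta>: "vanishing_mean (\<lambda>t. \<theta> (Suc t) - \<theta> t)"
    by (rule vanishing_mean_increments[OF compact_theta path_length]) (simp add: sum_nonneg)
  have d\<eta>: "vanishing_mean (\<lambda>t. \<eta> (Suc t) - \<eta> t)"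
    by (rule vanishing_mean_increments[OF compact_eta path_length]) (simp add: sum_nonneg)
  note contraction_u = gradient_step_contraction[OF scu smu eta gamma_v_pos gamma_v_upper]
  note contraction_x = gradient_step_contraction[OF scx smx theta gamma_x_pos gamma_x_upper]

  have ev: "vanishing_mean (\<lambda>t. v t - \<eta> t)"
  proof (rule vanishing_mean_contraction[OF contraction_u(2,3) d\<eta>])
    fix t
    have "norm (v (Suc t) - \<eta> (Suc t)) \<le> norm (v (Suc t) - \<eta> t) + norm (\<eta> (Suc t) - \<eta> t)"
      using norm_triangle_ineq4[of "v (Suc t) - \<eta> t" "\<eta> (Suc t) - \<eta> t"] by simp
    also have "norm (v (Suc t) - \<eta> t) \<le> (1 - \<gamma>\<^sub>v * \<alpha>\<^sub>u) * norm (v t - \<eta> t)"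
      unfolding v_step by (rule contraction_u(1))
    finally show "norm (v (Suc t) - \<eta> (Suc t))
        \<le> (1 - \<gamma>\<^sub>v * \<alpha>\<^sub>u) * norm (v t - \<eta> t) + norm (\<eta> (Suc t) - \<eta> t)" by simp
  qed
  have ev': "vanishing_mean (\<lambda>t. v (Suc t) - \<eta> t)"
    using vanishing_mean_add[OF ev[folded vanishing_mean_Suc_iff[of "\<lambda>t. v t - \<eta> t"]] d\<eta>] by simp
  have dv: "vanishing_mean (\<lambda>t. v (Suc t) - v t)"
    using vanishing_mean_diff[OF ev' ev] by simp
  have dv': "vanishing_mean (\<lambda>t. v (Suc (Suc t)) - v (Suc t))"
    using dv vanishing_mean_Suc_iff[of "\<lambda>t. v (Suc t) - v t"] by simp

  define a where "a = spectral_norm A"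
  define d where "d t = B *v (v (Suc t) - \<eta> t) + S *v stack (v (Suc (Suc t)) - v (Suc t))
    - (\<theta> (Suc t) - \<theta> t)" for t
  have d: "vanishing_mean d"
    unfolding d_def
    by (rule vanishing_mean_diff[OF vanishing_mean_add[OF
          vanishing_mean_linear[OF matrix_vector_mul_linear ev']
          vanishing_mean_linear[OF matrix_vector_mul_linear
            vanishing_mean_linear[OF linear_stack dv']]] d\<theta>])
  have a: "norm (A *v y) \<le> a * norm y" for y
    unfolding a_def spectral_norm_def by (rule onorm[OF matrix_vector_mul_bounded_linear])
  have a0: "0 \<le> a"
    unfolding a_def spectral_norm_def by (rule onorm_pos_le[OF matrix_vector_mul_bounded_linear])
  \<comment> \<open>For \<open>a > 0\<close> the lower bound on \<open>\<gamma>\<^sub>x\<close> says precisely that this product is below one half.\<close>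
  have \<rho>: "a * (1 - \<gamma>\<^sub>x * \<alpha>\<^sub>x) < 1"
  proof (cases "a = 0")
    case False
    then have "A \<noteq> 0" by (auto simp: a_def spectral_norm_def onorm_zero)
    moreover have "0 < \<alpha>\<^sub>x" using curvature_order[OF scx smx] by simp
    ultimately have "2 * a - 1 < \<gamma>\<^sub>x * (2 * a * \<alpha>\<^sub>x)"
      using gamma_x_lower a0 False by (simp add: a_def[symmetric] pos_divide_less_eq)
    then show ?thesis by (simp add: algebra_simps)
  qed simp
  \<comment> \<open>Pairing \<open>xhat (t + N)\<close> with \<open>\<theta> t\<close>, the minimizer of the cost whose gradient is evaluated there; the
    recursion then starts at \<open>t = 1\<close>, from where on \<open>\<theta> t\<close> is an equilibrium.\<close>
  have ex: "vanishing_mean (\<lambda>t. xhat (t + N) - \<theta> t)"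
  proof (rule vanishing_mean_contraction[OF _ \<rho> d])
    show "0 \<le> a * (1 - \<gamma>\<^sub>x * \<alpha>\<^sub>x)" using a0 contraction_x(2) by simp
  next
    fix t :: nat assume t: "t \<ge> 1"
    define y where "y = xhat (t + N)"
    have "xhat (Suc t + N) = A *v (y - \<gamma>\<^sub>x *\<^sub>R gradient (fx t) y) + B *v v (Suc t)
        + S *v stack (v (Suc (Suc t)) - v (Suc t))"
      using prediction_recursion[OF algorithm rank, of "Suc t"] by (simp add: S_def y_def N_def)
    moreover have "\<theta> t = A *v \<theta> t + B *v \<eta> t" using steady_state[OF t] .
    ultimately have "xhat (Suc t + N) - \<theta> (Suc t)
        = A *v (y - \<gamma>\<^sub>x *\<^sub>R gradient (fx t) y - \<theta> t) + d t"
      unfolding d_def matrix_vector_mult_diff_distrib by (simp add: algebra_simps)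
    then have "norm (xhat (Suc t + N) - \<theta> (Suc t))
        \<le> norm (A *v (y - \<gamma>\<^sub>x *\<^sub>R gradient (fx t) y - \<theta> t)) + norm (d t)"
      by (simp add: norm_triangle_ineq)
    also have "norm (A *v (y - \<gamma>\<^sub>x *\<^sub>R gradient (fx t) y - \<theta> t))
        \<le> a * ((1 - \<gamma>\<^sub>x * \<alpha>\<^sub>x) * norm (y - \<theta> t))"
      using a mult_left_mono[OF contraction_x(1) a0] by (rule order_trans)
    finally show "norm (xhat (Suc t + N) - \<theta> (Suc t))
        \<le> a * (1 - \<gamma>\<^sub>x * \<alpha>\<^sub>x) * norm (xhat (t + N) - \<theta> t) + norm (d t)"
      by (simp add: y_def mult.assoc)
  qed

  have g: "vanishing_mean g"
  proof -
    have "vanishing_mean (\<lambda>t. gradient (fx t) (xhat (t + N)))"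
      by (rule vanishing_mean_dominated[OF ex]) (rule gradient_norm_bounds(2)[OF scx smx theta])
    then have "vanishing_mean (\<lambda>t. - \<gamma>\<^sub>x *\<^sub>R ((transpose S ** matrix_inv (S ** transpose S))
              *v gradient (fx t) (xhat (t + N))))"
      by (rule vanishing_mean_linear[rotated])
        (intro linear_compose_scale_right matrix_vector_mul_linear)
    then have "vanishing_mean (\<lambda>t. g (Suc t))" by (simp only: g_eq n add_Suc add_Suc_right)
    then show ?thesis by (simp only: vanishing_mean_Suc_iff)
  qed

  have eu: "vanishing_mean (\<lambda>t. u t - \<eta> t)"
  proof (rule vanishing_mean_cong)
    show "vanishing_mean (\<lambda>t. (v t - \<eta> t) + (\<Sum>i=0..n. (e_mat ** matpow W_mat i) *v g (t - i)))"
      by (intro vanishing_mean_add[OF ev] vanishing_mean_sum finite_atLeastAtMost)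
        (rule vanishing_mean_linear[OF matrix_vector_mul_linear vanishing_mean_delay[OF g]])
  qed (simp add: u_eq)

  have exx: "vanishing_mean (\<lambda>t. x t - \<theta> t)"
  proof (rule vanishing_mean_deadbeat)
    have "vanishing_mean (\<lambda>t. u (Suc t) - \<eta> t)"
      using vanishing_mean_add[OF eu[folded vanishing_mean_Suc_iff[of "\<lambda>t. u t - \<eta> t"]] d\<eta>] by simp
    from vanishing_mean_diff[OF vanishing_mean_linear[OF matrix_vector_mul_linear this] d\<theta>]
    show "vanishing_mean (\<lambda>t. B *v (u (Suc t) - \<eta> t) - (\<theta> (Suc t) - \<theta> t))" .
    show "x (Suc t) - \<theta> (Suc t) = A *v (x t - \<theta> t) + (B *v (u (Suc t) - \<eta> t) - (\<theta> (Suc t) - \<theta> t))"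
      if "t \<ge> 1" for t
      using steady_state[OF that] x_eq[of "Suc t"]
      unfolding matrix_vector_mult_diff_distrib by (simp add: algebra_simps)
    have "vanishing_mean (\<lambda>t. \<Sum>i=1..n. matpow W_mat i *v g (Suc t - i))"
    proof (intro vanishing_mean_sum finite_atLeastAtMost)
      fix i
      have "vanishing_mean (\<lambda>t. g (Suc t - i))"
        using vanishing_mean_delay[OF g, of i] vanishing_mean_Suc_iff[of "\<lambda>t. g (t - i)"] by simp
      then show "vanishing_mean (\<lambda>t. matpow W_mat i *v g (Suc t - i))"
        by (rule vanishing_mean_linear[OF matrix_vector_mul_linear])
    qed
    then have R: "vanishing_mean (\<lambda>t. S *v (\<Sum>i=1..n. matpow W_mat i *v g (Suc t - i)))"
      by (rule vanishing_mean_linear[OF matrix_vector_mul_linear])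
    have V: "vanishing_mean (\<lambda>t. S *v stack (v (Suc t) - \<eta> t))"
      by (rule vanishing_mean_linear[OF matrix_vector_mul_linear
            vanishing_mean_linear[OF linear_stack ev']])
    \<comment> \<open>Solve the prediction formula for its state term and subtract the equilibrium over the same
      horizon.\<close>
    show "vanishing_mean (\<lambda>t. matpow A N *v (x t - \<theta> t))"
    proof (rule vanishing_mean_cong[OF vanishing_mean_diff[OF vanishing_mean_diff[OF ex V] R]])
      fix t :: nat assume "t \<ge> 1"
      from equilibrium_iterate[OF steady_state[OF this], where 'k = 'k]
      have "\<theta> t = matpow A N *v \<theta> t + S *v stack (\<eta> t)" by (simp only: N_def S_def)
      then have "matpow A N *v \<theta> t = \<theta> t - S *v stack (\<eta> t)" by (metis add_diff_cancel_right')
      moreover have "xhat (t + N) = matpow A N *v x t + S *v stack (v (Suc t))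
              + S *v (\<Sum>i=1..n. matpow W_mat i *v g (Suc t - i))"
        using xhat_eq[of t] by (simp only: n add_Suc add_Suc_right)
      ultimately show "matpow A N *v (x t - \<theta> t) = xhat (t + N) - \<theta> t - S *v stack (v (Suc t) - \<eta> t)
          - S *v (\<Sum>i=1..n. matpow W_mat i *v g (Suc t - i))"
        unfolding matrix_vector_mult_diff_distrib linear_diff[OF linear_stack] by simp
    qed
  qed

  show ?thesis
  proof (rule sublinear_dominated)
    have "sublinear (\<lambda>T. l\<^sub>x / 2 * (\<Sum>t=1..T. (norm (x t - \<theta> t))\<^sup>2))"
      "sublinear (\<lambda>T. l\<^sub>u / 2 * (\<Sum>t=1..T. (norm (u t - \<eta> t))\<^sup>2))"
      by (intro sublinear_cmult sublinear_sum_square exx eu)+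
    then show "sublinear (\<lambda>T. l\<^sub>x / 2 * (\<Sum>t=1..T. (norm (x t - \<theta> t))\<^sup>2)
        + l\<^sub>u / 2 * (\<Sum>t=1..T. (norm (u t - \<eta> t))\<^sup>2))"
      by (rule sublinear_add)
    fix T
    have "trajectory A B (x 0) T x u" using x_eq by (simp add: trajectory_def)
    then have "(\<Sum>t=1..T. L t (xopt T t) (uopt T t)) \<le> (\<Sum>t=1..T. L t (x t) (u t))"
      using optimal[of T] unfolding optimal_trajectory_def is_arg_min_linorder by fastforce
    then show "0 \<le> regret L x u (xopt T) (uopt T) T"
      by (simp add: regret_def sum_subtractf)
    have "L t (x t) (u t) - L t y w
        \<le> l\<^sub>x / 2 * (norm (x t - \<theta> t))\<^sup>2 + l\<^sub>u / 2 * (norm (u t - \<eta> t))\<^sup>2" for t y w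
    proof -
      have "fx t (x t) \<le> fx t (\<theta> t) + l\<^sub>x / 2 * (norm (x t - \<theta> t))\<^sup>2"
        using smx[of t] gradient_at_minimizer[OF scx smx theta] unfolding smooth_def
        by (metis add.right_neutral inner_zero_left)
      moreover have "fu t (u t) \<le> fu t (\<eta> t) + l\<^sub>u / 2 * (norm (u t - \<eta> t))\<^sup>2"
        using smu[of t] gradient_at_minimizer[OF scu smu eta] unfolding smooth_def
        by (metis add.right_neutral inner_zero_left)
      moreover have "fx t (\<theta> t) \<le> fx t y" "fu t (\<eta> t) \<le> fu t w"
        using theta[of t] eta[of t] by (simp_all add: is_minimizer_def is_arg_min_linorder)
      ultimately show ?thesis by (simp add: L)
    qed
    then have "regret L x u (xopt T) (uopt T) T
        \<le> (\<Sum>t=1..T. l\<^sub>x / 2 * (norm (x t - \<theta> t))\<^sup>2 + l\<^sub>u / 2 * (norm (u t - \<eta> t))\<^sup>2)"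
      unfolding regret_def by (rule sum_mono)
    then show "regret L x u (xopt T) (uopt T) T \<le> 0 + 1 * (l\<^sub>x / 2 * (\<Sum>t=1..T. (norm (x t - \<theta> t))\<^sup>2)
        + l\<^sub>u / 2 * (\<Sum>t=1..T. (norm (u t - \<eta> t))\<^sup>2))"
      by (simp add: sum.distrib sum_distrib_left)
  qed
qed

end
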